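(* Let $\ell\colon\hat{\mathcal Y}\times\mathcal Y\to\mathbb R_{\ge0}$ be a target loss with decomposition $\ell(\hat y,y)=\langle\boldsymbol\rho(y),\boldsymbol\ell^{\boldsymbol\rho}(\hat y)\rangle+c(y)$ and $\min_{\hat y\in\hat{\mathcal Y}}\ell(\hat y,y)=0$ for all $y\in\mathcal Y$. Let $\lambda>0$ and let $\Omega\colon\mathbb R^d\to\mathbb R\cup\{+\infty\}$ satisfy $\mathrm{dom}(\Omega)=\mathcal C$ and be $\lambda$-strongly convex over $\mathcal C$ with respect to the $\ell_2$-norm. Let $(\boldsymbol\theta,y)\in\mathbb R^d\times\mathcal Y$ and let $$\boldsymbol\pi(\boldsymbol\theta)\in\arg\min_{\boldsymbol\pi\in\triangle^N}\Omega^*(\boldsymbol\theta+\mathcal L^{\boldsymbol\rho}\boldsymbol\pi).$$ Then $$L_\Omega(\boldsymbol\theta+\mathcal L^{\boldsymbol\rho}\boldsymbol\pi(\boldsymbol\theta),y)\ge\frac\lambda2\left\|\nabla L_{\Omega_\tau}(\boldsymbol\theta,y)\right\|_2^2,$$ where $\nabla L_{\Omega_\tau}(\boldsymbol\theta,y)$ is the gradient of the convolutional Fenchel--Young loss with respect to its first argument.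
   Context: $\mathcal Y=[K]$ and $\hat{\mathcal Y}=[N]$ are finite sets of labels and predictions; $\triangle^N$ is the probability simplex over $\hat{\mathcal Y}$. In the decomposition of $\ell$, $\boldsymbol\rho\colon\mathcal Y\to\mathbb R^d$, $\boldsymbol\ell^{\boldsymbol\rho}\colon\hat{\mathcal Y}\to\mathbb R^d$ and $c\colon\mathcal Y\to\mathbb R$ are functions; $\mathcal L^{\boldsymbol\rho}\in\mathbb R^{d\times N}$ is the matrix whose column indexed by $\hat y$ is $\boldsymbol\ell^{\boldsymbol\rho}(\hat y)$; and $\mathcal C=\mathrm{conv}(\{\boldsymbol\rho(y):y\in\mathcal Y\})$. $\mathrm{dom}(\Omega)=\{\boldsymbol\mu:\Omega(\boldsymbol\mu)<+\infty\}$ and $\Omega^*(\boldsymbol\theta)=\sup_{\boldsymbol\mu\in\mathbb R^d}\{\langle\boldsymbol\theta,\boldsymbol\mu\rangle-\Omega(\boldsymbol\mu)\}$ is the convex conjugate. The Fenchel--Young loss generated by $\Omega$ is $L_\Omega(\boldsymbol\theta,y)=\Omega^*(\boldsymbol\theta)+\Omega(\boldsymbol\rho(y))-\langle\boldsymbol\theta,\boldsymbol\rho(y)\rangle$. Define $\tau(\boldsymbol\mu)=-\min_{\hat y\in\hat{\mathcal Y}}\langle\boldsymbol\mu,\boldsymbol\ell^{\boldsymbol\rho}(\hat y)\rangle$ for $\boldsymbol\mu\in\mathbb R^d$ and $\Omega_\tau=\Omega+\tau$. The convolutional Fenchel--Young loss is the Fenchel--Young loss generated by $\Omega_\tau$: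 $L_{\Omega_\tau}(\boldsymbol\theta,y)=\Omega_\tau^*(\boldsymbol\theta)+\Omega_\tau(\boldsymbol\rho(y))-\langle\boldsymbol\theta,\boldsymbol\rho(y)\rangle$. It is a known fact that, under the stated assumptions, $L_{\Omega_\tau}(\cdot,y)$ is differentiable on $\mathbb R^d$, so the gradient is well defined. *)

theory Defs
  imports "HOL-Analysis.Analysis"
begin

text \<open>
  Functions into the extended half-line are modelled as ereal-valued functions; that they do
  not take the value \<open>-\<infinity>\<close> is stated separately where it is required.
\<close>

definition effective_domain :: "('a \<Rightarrow> ereal) \<Rightarrow> 'a set" where
  "effective_domain f = {x. f x < \<infinity>}"

definition strongly_convex_on :: "real \<Rightarrow> 'a::real_inner set \<Rightarrow> ('a \<Rightarrow> ereal) \<Rightarrow> bool" where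
  "strongly_convex_on lam S f \<longleftrightarrow> convex S \<and>
     (\<forall>x\<in>S. \<forall>y\<in>S. \<forall>t\<in>{0..1}.
        f (t *\<^sub>R x + (1 - t) *\<^sub>R y)
          \<le> ereal t * f x + ereal (1 - t) * f y
              - ereal (lam / 2 * t * (1 - t) * (norm (x - y))\<^sup>2))"

definition convex_conjugate :: "('a::real_inner \<Rightarrow> ereal) \<Rightarrow> 'a \<Rightarrow> ereal" where
  "convex_conjugate f \<theta> = (SUP \<mu>. ereal (\<theta> \<bullet> \<mu>) - f \<mu>)"

definition fenchel_young_loss ::
    "('a::real_inner \<Rightarrow> ereal) \<Rightarrow> ('y \<Rightarrow> 'a) \<Rightarrow> 'a \<Rightarrow> 'y \<Rightarrow> ereal" where
  "fenchel_young_loss f \<rho> \<theta> y = convex_conjugate f \<theta> + f (\<rho> y) - ereal (\<theta> \<bullet> \<rho> y)"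

definition prob_simplex :: "(real ^ 'n) set" where
  "prob_simplex = {p. (\<forall>i. 0 \<le> p $ i) \<and> (\<Sum>i\<in>UNIV. p $ i) = 1}"

definition column_matrix :: "('n \<Rightarrow> real ^ 'd) \<Rightarrow> real ^ 'n ^ 'd" where
  "column_matrix v = (\<chi> i j. v j $ i)"

definition tau :: "('n::finite \<Rightarrow> 'a::real_inner) \<Rightarrow> 'a \<Rightarrow> real" where
  "tau l \<mu> = - (MIN yhat. \<mu> \<bullet> l yhat)"

definition Omega_tau :: "('a::real_inner \<Rightarrow> ereal) \<Rightarrow> ('n::finite \<Rightarrow> 'a) \<Rightarrow> 'a \<Rightarrow> ereal" where
  "Omega_tau f l \<mu> = f \<mu> + ereal (tau l \<mu>)"

definition conv_fenchel_young_loss ::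
    "('a::real_inner \<Rightarrow> ereal) \<Rightarrow> ('n::finite \<Rightarrow> 'a) \<Rightarrow> ('y \<Rightarrow> 'a) \<Rightarrow> 'a \<Rightarrow> 'y \<Rightarrow> ereal" where
  "conv_fenchel_young_loss f l \<rho> = fenchel_young_loss (Omega_tau f l) \<rho>"

text \<open>
  The finiteness requirement near \<open>x\<close> matters because real_of_ereal maps infinite values to 0:
  without it, a function that is constantly \<open>\<infinity>\<close> would have gradient 0.
\<close>

definition has_gradient :: "('a::real_inner \<Rightarrow> ereal) \<Rightarrow> 'a \<Rightarrow> 'a \<Rightarrow> bool" where
  "has_gradient f x g \<longleftrightarrow>
     (\<forall>\<^sub>F z in nhds x. \<bar>f z\<bar> \<noteq> \<infinity>) \<and> GDERIV (\<lambda>z. real_of_ereal (f z)) x :> g"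

definition gradient :: "('a::real_inner \<Rightarrow> ereal) \<Rightarrow> 'a \<Rightarrow> 'a" where
  "gradient f x = (THE g. has_gradient f x g)"

end

theory Submission
  imports Defs
begin

text \<open>
  If \<open>\<Omega>\<close> is strongly convex on a compact set, then maximizing sequences for \<open>\<Omega>\<^sup>*(\<eta>)\<close> accumulate
  at a point \<open>m\<close> such that
  \<open>\<Omega>(\<mu>) \<ge> \<langle>\<eta>, \<mu>\<rangle> - \<Omega>\<^sup>*(\<eta>) + \<lambda>/2 \<parallel>\<mu> - m\<parallel>\<^sup>2\<close> for all \<open>\<mu>\<close>, even though the supremum need not be attained
  (\<open>\<Omega>\<close> is not assumed lower semicontinuous). Taking \<open>\<mu> = \<rho>(y)\<close> and \<open>\<eta> = \<theta> + L\<pi>\<close> bounds the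
  Fenchel--Young loss from below by \<open>\<lambda>/2 \<parallel>\<rho>(y) - m\<parallel>\<^sup>2\<close>. Optimality of \<open>\<pi>\<close> gives
  \<open>\<langle>m, L\<pi>\<rangle> = -\<tau>(m)\<close>, whence
  \<open>z \<mapsto> \<Omega>\<^sub>\<tau>\<^sup>*(z)\<close> lies between \<open>\<Omega>\<^sup>*(\<eta>) + \<langle>z - \<theta>, m\<rangle>\<close> and the same plus a multiple of
  \<open>\<parallel>z - \<theta>\<parallel>\<^sup>2\<close>; so its gradient at \<open>\<theta>\<close> is \<open>m\<close>.
\<close>

section \<open>Gradients of extended-real functions\<close>

lemma has_gradient_unique:
  assumes "has_gradient f x g" "has_gradient f x h"
  shows "g = h"
  using assms unfolding has_gradient_def gderiv_def
  by (metis has_derivative_unique vector_eq_ldot)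

lemma gradient_eqI: "has_gradient f x g \<Longrightarrow> gradient f x = g"
  unfolding gradient_def using has_gradient_unique by blast

text \<open>At \<open>z = x\<close> both bounds equal \<open>a\<close>, so they fix the value there,
  and they agree to first order. Being real-valued, they also force \<open>h\<close> to be finite
  everywhere, as \<open>has_gradient\<close> requires near \<open>x\<close>.\<close>

lemma has_gradient_squeeze:
  fixes h :: "'a::real_inner \<Rightarrow> ereal"
  assumes lower: "\<And>z. ereal (a + (z - x) \<bullet> g) \<le> h z"
    and upper: "\<And>z. h z \<le> ereal (a + (z - x) \<bullet> g + K * (norm (z - x))\<^sup>2)"
  shows "has_gradient h x g"
proof -
  define r where "r z = real_of_ereal (h z)" for z
  have h: "h z = ereal (r z)" for z
    using lower[of z] upper[of z] unfolding r_def by (cases "h z") auto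
  have lo: "a + (z - x) \<bullet> g \<le> r z" and up: "r z \<le> a + (z - x) \<bullet> g + K * (norm (z - x))\<^sup>2" for z
    using lower[of z] upper[of z] by (simp_all add: h)
  have "r x = a" using lo[of x] up[of x] by simp
  have "(r has_derivative (\<lambda>v. v \<bullet> g)) (at x)"
  proof (rule has_derivativeI_sandwich[where e = 1 and H = "\<lambda>z. K * norm (z - x)"])
    show "bounded_linear (\<lambda>v. v \<bullet> g)" by (rule bounded_linear_inner_left)
    have "((\<lambda>z. K * norm (z - x)) \<longlongrightarrow> K * norm (x - x)) (at x)"
      by (intro tendsto_intros)
    then show "((\<lambda>z. K * norm (z - x)) \<longlongrightarrow> 0) (at x)" by simp
    fix z assume "z \<noteq> x"
    have "norm (r z - r x - (z - x) \<bullet> g) \<le> K * norm (z - x) * norm (z - x)"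
      using lo[of z] up[of z] \<open>r x = a\<close> by (simp add: power2_eq_square)
    then show "norm (r z - r x - (z - x) \<bullet> g) / norm (z - x) \<le> K * norm (z - x)"
      using \<open>z \<noteq> x\<close> by (simp add: divide_le_eq)
  qed simp
  then show ?thesis
    unfolding has_gradient_def gderiv_def r_def by (simp add: h)
qed

section \<open>Conjugates of strongly convex functions\<close>

lemma convex_conjugate_ge: "ereal (\<theta> \<bullet> \<mu>) - f \<mu> \<le> convex_conjugate f \<theta>"
  unfolding convex_conjugate_def by (rule SUP_upper) simp

text \<open>Strong convexity is applied between \<open>\<mu>\<close> and near-maximizers
  \<open>X k\<close>, and the value at the mixture is compared with the supremum \<open>F\<close>.
  The sequence is part of the conclusion because the value of \<open>f\<close> at \<open>m\<close>
  is not controlled: convergence of the objective along \<open>X\<close> stands in for attainment at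
  \<open>m\<close>.\<close>

lemma maximizing_sequence_limit:
  fixes f :: "'a::real_inner \<Rightarrow> ereal"
  assumes "compact S" and proper: "\<And>\<mu>. f \<mu> \<noteq> -\<infinity>" and dom: "effective_domain f = S"
    and sc: "strongly_convex_on lam S f" and F: "convex_conjugate f \<eta> = ereal F"
  obtains m X where "\<And>k::nat. X k \<in> S" "X \<longlonglongrightarrow> m"
    "(\<lambda>k. \<eta> \<bullet> X k - real_of_ereal (f (X k))) \<longlonglongrightarrow> F"
    "\<And>\<mu>. \<mu> \<in> S \<Longrightarrow> \<eta> \<bullet> \<mu> - F + lam / 2 * (norm (\<mu> - m))\<^sup>2 \<le> real_of_ereal (f \<mu>)"
proof -
  define r where "r \<mu> = real_of_ereal (f \<mu>)" for \<mu>
  have f: "f \<mu> = ereal (r \<mu>)" if "\<mu> \<in> S" for \<mu>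
    using that proper[of \<mu>] dom unfolding r_def effective_domain_def by (cases "f \<mu>") auto
  have out: "f \<mu> = \<infinity>" if "\<mu> \<notin> S" for \<mu>
    using that dom unfolding effective_domain_def by auto
  have le: "\<eta> \<bullet> \<mu> - r \<mu> \<le> F" if "\<mu> \<in> S" for \<mu>
    using convex_conjugate_ge[of \<eta> \<mu> f] by (simp add: F f that)
  have "\<exists>\<mu>\<in>S. F - inverse (real (Suc k)) < \<eta> \<bullet> \<mu> - r \<mu>" for k
  proof -
    have "ereal (F - inverse (real (Suc k))) < convex_conjugate f \<eta>" by (simp add: F)
    then obtain \<mu> where \<mu>: "ereal (F - inverse (real (Suc k))) < ereal (\<eta> \<bullet> \<mu>) - f \<mu>"
      unfolding convex_conjugate_def less_SUP_iff by blast
    \<comment> \<open>Outside \<open>S\<close> the objective is minus infinity, so near-maximizers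
      lie in \<open>S\<close>.\<close>
    then have "\<mu> \<in> S" using out[of \<mu>] by (cases "\<mu> \<in> S") auto
    then show ?thesis using \<mu> f by auto
  qed
  then obtain Y where Y: "\<And>k. Y k \<in> S" "\<And>k. F - inverse (real (Suc k)) < \<eta> \<bullet> Y k - r (Y k)"
    by metis
  obtain m s where "strict_mono s" and lim: "(Y \<circ> s) \<longlonglongrightarrow> m"
    using \<open>compact S\<close> Y(1) unfolding compact_def by metis
  define X where "X = Y \<circ> s"
  from lim have lim: "X \<longlonglongrightarrow> m" by (simp add: X_def)
  have XS: "X k \<in> S" for k by (simp add: X_def Y)
  have "(\<lambda>k. \<eta> \<bullet> Y k - r (Y k)) \<longlonglongrightarrow> F"
  proof (rule tendsto_sandwich)
    show "(\<lambda>k. F - inverse (real (Suc k))) \<longlonglongrightarrow> F"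
      using tendsto_diff[OF tendsto_const LIMSEQ_inverse_real_of_nat] by simp
    show "\<forall>\<^sub>F k in sequentially. F - inverse (real (Suc k)) \<le> \<eta> \<bullet> Y k - r (Y k)"
      using Y(2) by (simp add: less_imp_le)
    show "\<forall>\<^sub>F k in sequentially. \<eta> \<bullet> Y k - r (Y k) \<le> F"
      using le Y(1) by simp
  qed simp
  from LIMSEQ_subseq_LIMSEQ[OF this \<open>strict_mono s\<close>]
  have val: "(\<lambda>k. \<eta> \<bullet> X k - r (X k)) \<longlonglongrightarrow> F" by (simp add: X_def o_def)
  have "\<eta> \<bullet> \<mu> - F + lam / 2 * (norm (\<mu> - m))\<^sup>2 \<le> r \<mu>" if \<mu>: "\<mu> \<in> S" for \<mu>
  proof -
    \<comment> \<open>The order of limits matters: for fixed \<open>t\<close> the suboptimality of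
      \<open>X k\<close> vanishes as \<open>k\<close> grows; only then is the inequality divided by
      \<open>t\<close> and \<open>t\<close> sent to 0.\<close>
    have *: "lam / 2 * (1 - t) * (norm (\<mu> - m))\<^sup>2 \<le> F + r \<mu> - \<eta> \<bullet> \<mu>"
      if t: "0 < t" "t < 1" for t :: real
    proof -
      have step: "lam / 2 * t * (1 - t) * (norm (\<mu> - X k))\<^sup>2
          \<le> t * (F + r \<mu> - \<eta> \<bullet> \<mu>) + (1 - t) * (F - (\<eta> \<bullet> X k - r (X k)))" for k
      proof -
        let ?z = "t *\<^sub>R \<mu> + (1 - t) *\<^sub>R X k"
        have z: "?z \<in> S"
          using sc XS \<mu> t convexD[of S \<mu> "X k" t "1 - t"] unfolding strongly_convex_on_def by simp
        have "f ?z \<le> ereal t * f \<mu> + ereal (1 - t) * f (X k)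
            - ereal (lam / 2 * t * (1 - t) * (norm (\<mu> - X k))\<^sup>2)"
          using sc XS \<mu> t unfolding strongly_convex_on_def by simp
        then have "r ?z \<le> t * r \<mu> + (1 - t) * r (X k)
            - lam / 2 * t * (1 - t) * (norm (\<mu> - X k))\<^sup>2"
          using f z XS \<mu> by simp
        moreover have "t * (\<eta> \<bullet> \<mu>) + (1 - t) * (\<eta> \<bullet> X k) - r ?z \<le> F"
          using le[OF z] by (simp add: inner_simps)
        ultimately show ?thesis by (simp add: algebra_simps)
      qed
      have "(\<lambda>k. lam / 2 * t * (1 - t) * (norm (\<mu> - X k))\<^sup>2)
          \<longlonglongrightarrow> lam / 2 * t * (1 - t) * (norm (\<mu> - m))\<^sup>2"
        by (intro tendsto_intros lim)
      moreover have "(\<lambda>k. t * (F + r \<mu> - \<eta> \<bullet> \<mu>) + (1 - t) * (F - (\<eta> \<bullet> X k - r (X k))))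
          \<longlonglongrightarrow> t * (F + r \<mu> - \<eta> \<bullet> \<mu>) + (1 - t) * (F - F)"
        by (intro tendsto_intros val)
      ultimately have "lam / 2 * t * (1 - t) * (norm (\<mu> - m))\<^sup>2
          \<le> t * (F + r \<mu> - \<eta> \<bullet> \<mu>) + (1 - t) * (F - F)"
        by (rule LIMSEQ_le) (use step in blast)
      then have "t * (lam / 2 * (1 - t) * (norm (\<mu> - m))\<^sup>2) \<le> t * (F + r \<mu> - \<eta> \<bullet> \<mu>)"
        by (simp add: mult_ac)
      then show ?thesis using t by (simp only: mult_le_cancel_left_pos)
    qed
    have "((\<lambda>t. lam / 2 * (1 - t) * (norm (\<mu> - m))\<^sup>2)
        \<longlongrightarrow> lam / 2 * (1 - 0) * (norm (\<mu> - m))\<^sup>2) (at_right 0)"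
      by (intro tendsto_intros)
    moreover have "\<forall>\<^sub>F t in at_right 0. lam / 2 * (1 - t) * (norm (\<mu> - m))\<^sup>2 \<le> F + r \<mu> - \<eta> \<bullet> \<mu>"
      using * by (intro eventually_at_rightI[of 0 1]) auto
    ultimately have "lam / 2 * (1 - 0) * (norm (\<mu> - m))\<^sup>2 \<le> F + r \<mu> - \<eta> \<bullet> \<mu>"
      by (intro tendsto_upperbound) auto
    then show ?thesis by simp
  qed
  with XS lim val show thesis unfolding r_def by (rule that)
qed

text \<open>This is the smoothness dual to quadratic growth. With
  \<open>v = \<eta>' - \<eta>\<close> and \<open>w = \<mu> - m\<close>, growth leaves the concave
  quadratic \<open>v \<bullet> w - lam / 2 * (norm w)\<^sup>2\<close> to be maximized, and its
  maximum is \<open>(norm v)\<^sup>2 / (2 * lam)\<close>.\<close>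

lemma convex_conjugate_quadratic_upper:
  fixes f :: "'a::real_inner \<Rightarrow> ereal"
  assumes "0 < lam" and proper: "\<And>\<mu>. f \<mu> \<noteq> -\<infinity>"
    and growth: "\<And>\<mu>. \<mu> \<in> effective_domain f \<Longrightarrow>
      \<eta> \<bullet> \<mu> - F + lam / 2 * (norm (\<mu> - m))\<^sup>2 \<le> real_of_ereal (f \<mu>)"
  shows "convex_conjugate f \<eta>'
    \<le> ereal (F + (\<eta>' - \<eta>) \<bullet> m + (norm (\<eta>' - \<eta>))\<^sup>2 / (2 * lam))"
  unfolding convex_conjugate_def
proof (rule SUP_least)
  fix \<mu>
  show "ereal (\<eta>' \<bullet> \<mu>) - f \<mu> \<le> ereal (F + (\<eta>' - \<eta>) \<bullet> m + (norm (\<eta>' - \<eta>))\<^sup>2 / (2 * lam))"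
  proof (cases "f \<mu>")
    case (real r)
    let ?v = "\<eta>' - \<eta>" and ?w = "\<mu> - m"
    have "\<eta> \<bullet> \<mu> - F + lam / 2 * (norm ?w)\<^sup>2 \<le> r"
      using growth[of \<mu>] real by (simp add: effective_domain_def)
    moreover have "?v \<bullet> ?w \<le> lam / 2 * (norm ?w)\<^sup>2 + (norm ?v)\<^sup>2 / (2 * lam)"
    proof -
      \<comment> \<open>Completing the square; the square vanishes at the maximizer
        \<open>?w = ?v / lam\<close>.\<close>
      have "0 \<le> (norm (lam *\<^sub>R ?w - ?v))\<^sup>2 / (2 * lam)" using \<open>0 < lam\<close> by simp
      also have "(norm (lam *\<^sub>R ?w - ?v))\<^sup>2
          = lam\<^sup>2 * (norm ?w)\<^sup>2 - 2 * lam * (?v \<bullet> ?w) + (norm ?v)\<^sup>2"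
        unfolding power2_norm_eq_inner
        by (subst inner_diff_left, subst (1 2) inner_diff_right)
          (simp add: inner_commute[of ?w ?v] power2_eq_square del: inner_diff_left inner_diff_right)
      also have "\<dots> / (2 * lam)
          = lam / 2 * (norm ?w)\<^sup>2 + (norm ?v)\<^sup>2 / (2 * lam) - ?v \<bullet> ?w"
        using \<open>0 < lam\<close> by (simp add: field_simps power2_eq_square)
      finally show ?thesis by simp
    qed
    ultimately show ?thesis using real by (simp add: inner_diff_left inner_diff_right)
  qed (use proper in auto)
qed

section \<open>Bounds and continuity for \<open>tau\<close>\<close>

lemma column_matrix_mult: "column_matrix v *v p = (\<Sum>i\<in>UNIV. p $ i *\<^sub>R v i)"
  by (simp add: vec_eq_iff column_matrix_def matrix_vector_mult_def mult.commute)

lemma neg_tau_le: "- tau l \<mu> \<le> \<mu> \<bullet> l i"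
  unfolding tau_def minus_minus by (intro Min_le) auto

lemma neg_tau_ge: "(\<And>i. a \<le> \<mu> \<bullet> l i) \<Longrightarrow> a \<le> - tau l \<mu>"
  unfolding tau_def minus_minus by simp

lemma neg_tau_le_column_matrix:
  fixes l :: "'n::finite \<Rightarrow> real ^ 'd"
  assumes "p \<in> prob_simplex"
  shows "- tau l \<mu> \<le> (column_matrix l *v p) \<bullet> \<mu>"
proof -
  have "- tau l \<mu> = (\<Sum>i\<in>UNIV. p $ i * - tau l \<mu>)"
    using assms by (simp only: prob_simplex_def sum_distrib_right[symmetric]) simp
  also have "\<dots> \<le> (\<Sum>i\<in>UNIV. p $ i * (\<mu> \<bullet> l i))"
    using assms by (intro sum_mono mult_left_mono neg_tau_le) (auto simp: prob_simplex_def)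
  finally show ?thesis
    by (simp add: column_matrix_mult inner_sum_left inner_commute[of \<mu>])
qed

text \<open>A minimum of finitely many linear forms is Lipschitz; the sum \<open>?B\<close> is a
  crude constant dominating every \<open>norm (l i)\<close>.\<close>

lemma tau_tendsto:
  fixes l :: "'n::finite \<Rightarrow> 'a::real_inner"
  assumes "(X \<longlongrightarrow> m) A"
  shows "((\<lambda>k. tau l (X k)) \<longlongrightarrow> tau l m) A"
proof -
  let ?B = "\<Sum>i\<in>UNIV. norm (l i)"
  have lip: "tau l a - tau l b \<le> norm (a - b) * ?B" for a b
  proof -
    have "- tau l b - norm (a - b) * ?B \<le> - tau l a"
    proof (rule neg_tau_ge)
      fix i
      have "(b - a) \<bullet> l i \<le> norm (b - a) * norm (l i)" by (rule norm_cauchy_schwarz)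
      also have "\<dots> \<le> norm (a - b) * ?B"
        unfolding norm_minus_commute[of b a]
        by (intro mult_left_mono member_le_sum) auto
      finally show "- tau l b - norm (a - b) * ?B \<le> a \<bullet> l i"
        using neg_tau_le[of l b i] by (simp add: inner_diff_left)
    qed
    then show ?thesis by simp
  qed
  show ?thesis
  proof (rule LIM_zero_cancel, rule Lim_null_comparison)
    show "\<forall>\<^sub>F k in A. norm (tau l (X k) - tau l m) \<le> norm (X k - m) * ?B"
      using lip[of "X _" m] lip[of m "X _"] by (simp add: abs_le_iff norm_minus_commute)
    have "((\<lambda>k. norm (X k - m) * ?B) \<longlongrightarrow> norm (m - m) * ?B) A"
      using assms by (intro tendsto_intros)
    then show "((\<lambda>k. norm (X k - m) * ?B) \<longlongrightarrow> 0) A" by simp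
  qed
qed

section \<open>Optimality of the mixture and the gradient of the convolutional loss\<close>

theorem lemma4p4:
  fixes loss :: "'n::finite \<Rightarrow> 'k::finite \<Rightarrow> real"
    and \<rho> :: "'k \<Rightarrow> real ^ 'd"
    and loss\<rho> :: "'n \<Rightarrow> real ^ 'd"
    and c :: "'k \<Rightarrow> real"
    and \<Omega> :: "real ^ 'd \<Rightarrow> ereal"
    and lam :: real
    and \<theta> :: "real ^ 'd"
    and y :: 'k
    and \<pi> :: "real ^ 'n"
  assumes loss_nonneg: "\<And>yhat y. 0 \<le> loss yhat y"
    and loss_decomp: "\<And>yhat y. loss yhat y = \<rho> y \<bullet> loss\<rho> yhat + c y"
    and loss_min: "\<And>y. (MIN yhat. loss yhat y) = 0"
    and lam_pos: "0 < lam"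
    and Omega_proper: "\<And>\<mu>. \<Omega> \<mu> \<noteq> -\<infinity>"
    and Omega_dom: "effective_domain \<Omega> = convex hull (range \<rho>)"
    and Omega_sc: "strongly_convex_on lam (convex hull (range \<rho>)) \<Omega>"
    and pi_argmin:
      "is_arg_min (\<lambda>p. convex_conjugate \<Omega> (\<theta> + column_matrix loss\<rho> *v p))
         (\<lambda>p. p \<in> prob_simplex) \<pi>"
  shows "fenchel_young_loss \<Omega> \<rho> (\<theta> + column_matrix loss\<rho> *v \<pi>) y
    \<ge> ereal (lam / 2 *
        (norm (gradient (\<lambda>\<theta>'. conv_fenchel_young_loss \<Omega> loss\<rho> \<rho> \<theta>' y) \<theta>))\<^sup>2)"
proof -
  let ?S = "convex hull range \<rho>" and ?L = "column_matrix loss\<rho>"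
  define \<eta> where "\<eta> = \<theta> + ?L *v \<pi>"
  have \<pi>: "\<pi> \<in> prob_simplex"
    and min: "\<And>p. p \<in> prob_simplex \<Longrightarrow>
      convex_conjugate \<Omega> \<eta> \<le> convex_conjugate \<Omega> (\<theta> + ?L *v p)"
    using pi_argmin unfolding is_arg_min_def \<eta>_def by (auto simp: not_less)
  have "\<rho> y \<in> ?S" by (simp add: hull_inc)
  have fin: "\<Omega> \<mu> = ereal (real_of_ereal (\<Omega> \<mu>))" if "\<mu> \<in> ?S" for \<mu>
    using that Omega_proper[of \<mu>] Omega_dom unfolding effective_domain_def
    by (cases "\<Omega> \<mu>") auto
  note \<Omega>y = fin[OF \<open>\<rho> y \<in> ?S\<close>]
  show ?thesis
  \<comment> \<open>An infinite conjugate makes the left-hand loss infinite, so this split replaces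
    a proof of finiteness.\<close>
  proof (cases "convex_conjugate \<Omega> \<eta> = \<infinity>")
    case True
    then have "fenchel_young_loss \<Omega> \<rho> \<eta> y = \<infinity>"
      unfolding fenchel_young_loss_def by (subst \<Omega>y) simp
    then show ?thesis by (simp add: \<eta>_def)
  next
    case False
    moreover have "convex_conjugate \<Omega> \<eta> \<noteq> -\<infinity>"
      using convex_conjugate_ge[of \<eta> "\<rho> y" \<Omega>] by (subst (asm) \<Omega>y) auto
    ultimately obtain F where F: "convex_conjugate \<Omega> \<eta> = ereal F"
      by (cases "convex_conjugate \<Omega> \<eta>") auto
    have "compact ?S" by (simp add: finite_imp_compact compact_convex_hull)
    then obtain X m where XS: "\<And>k::nat. X k \<in> ?S" and X: "X \<longlonglongrightarrow> m"
      and val: "(\<lambda>k. \<eta> \<bullet> X k - real_of_ereal (\<Omega> (X k))) \<longlonglongrightarrow> F"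
      and growth: "\<And>\<mu>. \<mu> \<in> ?S \<Longrightarrow>
        \<eta> \<bullet> \<mu> - F + lam / 2 * (norm (\<mu> - m))\<^sup>2 \<le> real_of_ereal (\<Omega> \<mu>)"
      by (rule maximizing_sequence_limit[OF _ Omega_proper Omega_dom Omega_sc F]) (rule that)
    have upper: "convex_conjugate \<Omega> \<eta>'
        \<le> ereal (F + (\<eta>' - \<eta>) \<bullet> m + (norm (\<eta>' - \<eta>))\<^sup>2 / (2 * lam))" for \<eta>'
      by (rule convex_conjugate_quadratic_upper[OF lam_pos Omega_proper])
        (use growth in \<open>simp add: Omega_dom\<close>)
    \<comment> \<open>First-order optimality of \<open>\<pi>\<close>, with \<open>m\<close> as the
      gradient of the conjugate at \<open>\<eta>\<close>. If the inequality failed, moving a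
      fraction \<open>s\<close> from \<open>\<pi>\<close> towards vertex \<open>i\<close> would
      change the objective by at most \<open>s * (v \<bullet> m)\<close>, which is negative, plus a
      term of order \<open>s\<^sup>2\<close>; for small \<open>s\<close> this contradicts
      minimality.\<close>
    have "(?L *v \<pi>) \<bullet> m \<le> m \<bullet> loss\<rho> i" for i
    proof (rule ccontr)
      define v where "v = loss\<rho> i - ?L *v \<pi>"
      assume "\<not> ?thesis"
      then have "v \<bullet> m < 0" by (simp add: v_def inner_diff_left inner_commute[of m])
      have small: "- (v \<bullet> m) \<le> s * ((norm v)\<^sup>2 / (2 * lam))" if s: "0 < s" "s < 1" for s :: real
      proof -
        let ?p = "(1 - s) *\<^sub>R \<pi> + s *\<^sub>R axis i 1"
        have "?p \<in> prob_simplex"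
          using \<pi> s by (auto simp: prob_simplex_def sum.distrib axis_def simp flip: sum_distrib_left)
        moreover have "?L *v ?p = ?L *v \<pi> + s *\<^sub>R v"
        proof -
          have "?L *v axis i 1 = loss\<rho> i"
            by (simp add: column_matrix_mult axis_def if_distrib[of "\<lambda>a. a *\<^sub>R _"] cong: if_cong)
          then show ?thesis
            by (simp add: v_def matrix_vector_right_distrib matrix_vector_mult_scaleR algebra_simps)
        qed
        ultimately have "ereal F \<le> convex_conjugate \<Omega> (\<eta> + s *\<^sub>R v)"
          using min[of ?p] unfolding F by (simp add: \<eta>_def add.assoc)
        also have "\<dots> \<le> ereal (F + s * (v \<bullet> m) + s\<^sup>2 * (norm v)\<^sup>2 / (2 * lam))"
          using upper[of "\<eta> + s *\<^sub>R v"] by (simp add: power_mult_distrib)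
        finally have "s * - (v \<bullet> m) \<le> s * (s * ((norm v)\<^sup>2 / (2 * lam)))"
          by (simp add: power2_eq_square)
        then show ?thesis using s by (simp only: mult_le_cancel_left_pos)
      qed
      have "((\<lambda>s. s * ((norm v)\<^sup>2 / (2 * lam))) \<longlongrightarrow> 0 * ((norm v)\<^sup>2 / (2 * lam))) (at_right 0)"
        by (intro tendsto_intros)
      moreover have "\<forall>\<^sub>F s in at_right 0. - (v \<bullet> m) \<le> s * ((norm v)\<^sup>2 / (2 * lam))"
        using small by (intro eventually_at_rightI[of 0 1]) auto
      ultimately have "- (v \<bullet> m) \<le> 0 * ((norm v)\<^sup>2 / (2 * lam))"
        by (intro tendsto_lowerbound) auto
      with \<open>v \<bullet> m < 0\<close> show False by simp
    qed
    then have tau_m: "(?L *v \<pi>) \<bullet> m \<le> - tau loss\<rho> m" by (rule neg_tau_ge)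

    define h where "h z = conv_fenchel_young_loss \<Omega> loss\<rho> \<rho> z y" for z
    \<comment> \<open>\<open>w\<close> is the finite value of \<open>Omega_tau\<close> at
      \<open>\<rho> y\<close>. Thus \<open>h\<close> is the conjugate plus an affine function of
      slope \<open>- \<rho> y\<close>, which shifts the gradient from \<open>m\<close> to
      \<open>m - \<rho> y\<close>.\<close>
    define w where "w = real_of_ereal (\<Omega> (\<rho> y)) + tau loss\<rho> (\<rho> y)"
    have h: "h z = convex_conjugate (Omega_tau \<Omega> loss\<rho>) z + ereal w - ereal (z \<bullet> \<rho> y)" for z
      unfolding h_def w_def conv_fenchel_young_loss_def fenchel_young_loss_def
        Omega_tau_def[of _ _ "\<rho> y"]
      by (subst \<Omega>y) simp
    have conj_lower: "ereal (F + (z - \<theta>) \<bullet> m) \<le> convex_conjugate (Omega_tau \<Omega> loss\<rho>) z" for z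
    proof -
      \<comment> \<open>\<open>?b k\<close> is the conjugate's objective at the test point
        \<open>X k\<close>, regrouped around \<open>\<eta>\<close> so that each summand has a known
        limit.\<close>
      let ?b = "\<lambda>k. (\<eta> \<bullet> X k - real_of_ereal (\<Omega> (X k))) + (z - \<eta>) \<bullet> X k - tau loss\<rho> (X k)"
      have "ereal (F + (z - \<theta>) \<bullet> m) \<le> ereal (F + (z - \<eta>) \<bullet> m - tau loss\<rho> m)"
        using tau_m by (simp add: \<eta>_def inner_diff_left inner_add_left)
      also have "\<dots> \<le> convex_conjugate (Omega_tau \<Omega> loss\<rho>) z"
      proof (rule LIMSEQ_le_const2)
        show "(\<lambda>k. ereal (?b k)) \<longlonglongrightarrow> ereal (F + (z - \<eta>) \<bullet> m - tau loss\<rho> m)"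
          by (intro tendsto_intros val X tau_tendsto)
        have "ereal (?b k) \<le> convex_conjugate (Omega_tau \<Omega> loss\<rho>) z" for k
          using convex_conjugate_ge[of z "X k" "Omega_tau \<Omega> loss\<rho>"]
          unfolding Omega_tau_def[of _ _ "X k"]
          by (subst (asm) fin[OF XS]) (simp add: inner_diff_left algebra_simps)
        then show "\<exists>N. \<forall>k\<ge>N. ereal (?b k) \<le> convex_conjugate (Omega_tau \<Omega> loss\<rho>) z"
          by blast
      qed
      finally show ?thesis .
    qed
    have conj_upper: "convex_conjugate (Omega_tau \<Omega> loss\<rho>) z
        \<le> ereal (F + (z - \<theta>) \<bullet> m + (norm (z - \<theta>))\<^sup>2 / (2 * lam))" for z
    proof -
      \<comment> \<open>A mixture dominates the minimum, so \<open>tau\<close> is at least the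
        linear form \<open>- (?L *v \<pi>) \<bullet> \<mu>\<close>. Replacing \<open>tau\<close> by
        that form only raises the objective and shifts the argument of the conjugate by
        \<open>?L *v \<pi>\<close>.\<close>
      have "convex_conjugate (Omega_tau \<Omega> loss\<rho>) z \<le> convex_conjugate \<Omega> (z + ?L *v \<pi>)"
        unfolding convex_conjugate_def[of "Omega_tau _ _"]
      proof (rule SUP_least)
        fix \<mu>
        have "ereal (z \<bullet> \<mu>) - Omega_tau \<Omega> loss\<rho> \<mu> \<le> ereal ((z + ?L *v \<pi>) \<bullet> \<mu>) - \<Omega> \<mu>"
          using neg_tau_le_column_matrix[OF \<pi>, of loss\<rho> \<mu>] Omega_proper[of \<mu>]
          unfolding Omega_tau_def by (cases "\<Omega> \<mu>") (auto simp: inner_add_left)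
        also have "\<dots> \<le> convex_conjugate \<Omega> (z + ?L *v \<pi>)" by (rule convex_conjugate_ge)
        finally show "ereal (z \<bullet> \<mu>) - Omega_tau \<Omega> loss\<rho> \<mu>
          \<le> convex_conjugate \<Omega> (z + ?L *v \<pi>)" .
      qed
      also have "\<dots> \<le> ereal (F + (z - \<theta>) \<bullet> m + (norm (z - \<theta>))\<^sup>2 / (2 * lam))"
        using upper[of "z + ?L *v \<pi>"] by (simp add: \<eta>_def)
      finally show ?thesis .
    qed
    have "has_gradient h \<theta> (m - \<rho> y)"
    proof (rule has_gradient_squeeze)
      fix z
      obtain q where q: "convex_conjugate (Omega_tau \<Omega> loss\<rho>) z = ereal q"
        using conj_lower[of z] conj_upper[of z]
        by (cases "convex_conjugate (Omega_tau \<Omega> loss\<rho>) z") auto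
      show "ereal ((F + w - \<theta> \<bullet> \<rho> y) + (z - \<theta>) \<bullet> (m - \<rho> y)) \<le> h z"
        using conj_lower[of z] by (simp add: h q inner_diff_left inner_diff_right)
      show "h z \<le> ereal ((F + w - \<theta> \<bullet> \<rho> y) + (z - \<theta>) \<bullet> (m - \<rho> y)
          + 1 / (2 * lam) * (norm (z - \<theta>))\<^sup>2)"
        using conj_upper[of z] by (simp add: h q inner_diff_left inner_diff_right)
    qed
    then have "gradient h \<theta> = m - \<rho> y" by (rule gradient_eqI)
    moreover have "ereal (lam / 2 * (norm (m - \<rho> y))\<^sup>2) \<le> fenchel_young_loss \<Omega> \<rho> \<eta> y"
      unfolding fenchel_young_loss_def F using growth[OF \<open>\<rho> y \<in> ?S\<close>]
      by (subst \<Omega>y) (simp add: norm_minus_commute)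
    ultimately show ?thesis by (simp flip: h_def \<eta>_def)
  qed
qed

end
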